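(* Let $X$ be a Hilbert space and $T:X\to X$ a nonexpansive mapping with $Fix(T)\ne\emptyset$. Let $\lambda\in(0,1)$, $L\in\mathbb{N}^*$, $r^*\in X$, $x\in X$, and let $(x_n)$ be given by $$x_0=x,\quad x_{n+1}=(1-\lambda)x_n+\lambda Tx_n+\frac1{(n+L)^2}r^*\quad\text{for all }n\in\mathbb{N}.$$ Let $\Lambda=\left\lceil\frac1{\lambda(1-\lambda)}\right\rceil$ and let $b\in\mathbb{N}^*$ be such that $b\ge\max\{\|x-z\|,\|z\|\}$ for some fixed point $z$ of $T$. Then $(x_n)$ is $T$-asymptotically regular with rate $$\Phi^*(k)=16\Lambda(b+2\lceil\|r^*\|\rceil)(b+4\lceil\|r^*\|\rceil+1)(k+1)^2+8\Lambda\lceil\|r^*\|\rceil(k+1)+\Lambda$$ and asymptotically regular with rate $$\Psi^*(k)=64\Lambda(b+2\lceil\|r^*\|\rceil)(b+4\lceil\|r^*\|\rceil+1)(k+1)^2+16\Lambda\lceil\|r^*\|\rceil(k+1)+\Lambda.$$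
   Context: $\mathbb{N}=\{0,1,2,\dots\}$, $\mathbb{N}^*=\mathbb{N}\setminus\{0\}$. $T$ is nonexpansive if $\|Tx-Ty\|\le\|x-y\|$ for all $x,y$; $Fix(T)$ is its set of fixed points. A function $\varphi:\mathbb{N}\to\mathbb{N}$ is a rate of convergence of a real sequence $(a_n)$ towards $0$ if for all $k\in\mathbb{N}$, $|a_n|\le\frac1{k+1}$ for all $n\ge\varphi(k)$. $(x_n)$ is $T$-asymptotically regular with rate $\Phi$ if $\Phi$ is a rate of convergence of $(\|x_n-Tx_n\|)$ towards $0$; it is asymptotically regular with rate $\Psi$ if $\Psi$ is a rate of convergence of $(\|x_{n+1}-x_n\|)$ towards $0$. *)

theory Defs
  imports "HOL-Analysis.Analysis"
begin

definition nonexpansive :: "('a::real_normed_vector \<Rightarrow> 'a) \<Rightarrow> bool" where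
  "nonexpansive T \<longleftrightarrow> (\<forall>x y. norm (T x - T y) \<le> norm (x - y))"

definition Fix :: "('a \<Rightarrow> 'a) \<Rightarrow> 'a set" where
  "Fix T = {x. T x = x}"

definition rate_of_convergence_to_0 :: "(nat \<Rightarrow> real) \<Rightarrow> (nat \<Rightarrow> nat) \<Rightarrow> bool" where
  "rate_of_convergence_to_0 a \<phi> \<longleftrightarrow> (\<forall>k. \<forall>n\<ge>\<phi> k. \<bar>a n\<bar> \<le> 1 / (real k + 1))"

definition T_asymptotically_regular_with_rate ::
  "('a::real_normed_vector \<Rightarrow> 'a) \<Rightarrow> (nat \<Rightarrow> 'a) \<Rightarrow> (nat \<Rightarrow> nat) \<Rightarrow> bool" where
  "T_asymptotically_regular_with_rate T x \<Phi> \<longleftrightarrow>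
     rate_of_convergence_to_0 (\<lambda>n. norm (x n - T (x n))) \<Phi>"

definition asymptotically_regular_with_rate ::
  "(nat \<Rightarrow> 'a::real_normed_vector) \<Rightarrow> (nat \<Rightarrow> nat) \<Rightarrow> bool" where
  "asymptotically_regular_with_rate x \<Psi> \<longleftrightarrow>
     rate_of_convergence_to_0 (\<lambda>n. norm (x (Suc n) - x n)) \<Psi>"

end

theory Submission
  imports Defs
begin

text \<open>
  Fix a fixed point \<open>z\<close>. The error terms satisfy \<open>1 / (n + L)\<^sup>2 \<le> p n - p (n + 1)\<close> with
  \<open>p n = 2 / (n + 1)\<close>, so every perturbed monotonicity becomes an honest one after adding a
  multiple of \<open>p\<close>. With \<open>M = b + 2R\<close>, \<open>c = \<lambda> (1 - \<lambda>)\<close> and \<open>S n = norm (x\<^sub>n - T x\<^sub>n)\<close>, the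
  sequences \<open>norm (x\<^sub>n - z) + R p n\<close>, \<open>S n + 2 R p n\<close> and
  \<open>(norm (x\<^sub>n - z))\<^sup>2 + c (\<Sum>i<n. (S i)\<^sup>2) + 2 M R p n\<close> are nonincreasing. Hence \<open>\<Sum> (S i)\<^sup>2\<close> is
  bounded, and if \<open>S n\<close> were larger than \<open>1 / (k + 1)\<close> then \<open>S i > 1 / (2 (k + 1))\<close> for all
  \<open>i\<close> from \<open>8 R (k + 1)\<close> to \<open>n\<close>, which overshoots this bound as soon as \<open>n \<ge> \<Phi>\<^sup>* k\<close>.
\<close>

section \<open>Preliminaries on inner product spaces and real sequences\<close>

lemma norm_convex_combination_sq:
  fixes u v :: "'a::real_inner"
  shows "(norm ((1 - t) *\<^sub>R u + t *\<^sub>R v))\<^sup>2 =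
    (1 - t) * (norm u)\<^sup>2 + t * (norm v)\<^sup>2 - t * (1 - t) * (norm (u - v))\<^sup>2"
  unfolding power2_norm_eq_inner
  by (simp add: inner_add_left inner_add_right inner_diff_left inner_diff_right inner_commute
      algebra_simps)

text \<open>Descent of \<open>S + q\<close> carries a large \<open>S n\<close> back to earlier
  indices, at the cost of \<open>q i\<close>, which is at most \<open>d\<close> from
  \<open>m\<close> on. If \<open>S n > 2 * d\<close>, each of the \<open>n + 1 - m\<close> indices
  from \<open>m\<close> to \<open>n\<close> thus contributes at least \<open>d\<^sup>2\<close> to
  the sum.\<close>

lemma le_twice_if_sum_squares_bounded:
  fixes S q :: "nat \<Rightarrow> real"
  assumes S_q: "antimono (\<lambda>n. S n + q n)"
    and q: "antimono q" "0 \<le> q n" "q m \<le> d"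
    and "0 \<le> d" "m \<le> n"
    and sum: "(\<Sum>i<Suc n. (S i)\<^sup>2) \<le> C"
    and C: "C < (real (Suc n) - real m) * d\<^sup>2"
  shows "S n \<le> 2 * d"
proof (rule ccontr)
  assume *: "\<not> S n \<le> 2 * d"
  have "d\<^sup>2 \<le> (S i)\<^sup>2" if "i \<in> {m..<Suc n}" for i
  proof -
    have "S n + q n \<le> S i + q i" "q i \<le> q m"
      using antimonoD[OF S_q, of i n] antimonoD[OF q(1), of m i] that by auto
    then have "d \<le> S i"
      using * q by linarith
    then show ?thesis
      using \<open>0 \<le> d\<close> by (rule power_mono)
  qed
  then have "(\<Sum>i\<in>{m..<Suc n}. d\<^sup>2) \<le> (\<Sum>i\<in>{m..<Suc n}. (S i)\<^sup>2)"
    by (rule sum_mono)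
  also have "\<dots> \<le> (\<Sum>i<Suc n. (S i)\<^sup>2)"
    by (rule sum_mono2) auto
  finally show False
    using sum C \<open>m \<le> n\<close> by (simp add: of_nat_diff)
qed

text \<open>The worst case is \<open>L = 1\<close>. There \<open>n + 2 \<le> 2 * (n + 1)\<close>
  replaces one factor \<open>n + 1\<close> of the denominator, which is where the numerator 2 comes
  from.\<close>

lemma inverse_square_le_telescope:
  fixes L :: nat
  assumes "L \<ge> 1"
  shows "1 / (real n + real L)\<^sup>2 \<le> 2 / (real n + 1) - 2 / (real n + 2)"
proof -
  have "1 / (real n + real L)\<^sup>2 \<le> 1 / (real n + 1)\<^sup>2"
    using assms by (intro divide_left_mono power_mono mult_pos_pos) auto
  also have "\<dots> \<le> 2 / ((real n + 1) * (real n + 2))"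
    by (simp add: divide_simps power2_eq_square)
  also have "\<dots> = 2 / (real n + 1) - 2 / (real n + 2)"
    by (simp add: divide_simps)
  finally show ?thesis .
qed

text \<open>The errors enter the estimates only through a telescoping bound, so they are kept
  abstract. Their norms sum to at most \<open>2 * R\<close>.\<close>

locale perturbed_KM =
  fixes T :: "'a::real_inner \<Rightarrow> 'a" and lam :: real and e xs :: "nat \<Rightarrow> 'a"
    and R B :: real and z :: 'a
  assumes nonexp: "nonexpansive T"
    and lam: "0 < lam" "lam < 1"
    and step: "xs (Suc n) = (1 - lam) *\<^sub>R xs n + lam *\<^sub>R T (xs n) + e n"
    and fixpoint: "T z = z"
    and R: "0 \<le> R"
    and error: "norm (e n) \<le> R * (2 / (real n + 1) - 2 / (real n + 2))"
    and start: "norm (xs 0 - z) \<le> B"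
begin

abbreviation S :: "nat \<Rightarrow> real" where
  "S n \<equiv> norm (xs n - T (xs n))"

abbreviation p :: "nat \<Rightarrow> real" where
  "p n \<equiv> 2 / (real n + 1)"

section \<open>Distance to the fixed point and sum of the squared residuals\<close>

lemma error_p: "norm (e n) \<le> R * p n - R * p (Suc n)"
  using error[of n] by (simp add: right_diff_distrib add.commute)

lemma R_p_nonneg: "0 \<le> R * p n"
  using R by simp

text \<open>Since \<open>T z = z\<close>, nonexpansiveness bounds the second vector of the convex
  combination by the first, and the negative term of the norm identity remains as a gain.\<close>

lemma KM_step_sq:
  "(norm ((1 - lam) *\<^sub>R xs n + lam *\<^sub>R T (xs n) - z))\<^sup>2
     \<le> (norm (xs n - z))\<^sup>2 - lam * (1 - lam) * (S n)\<^sup>2"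
proof -
  have eq: "(1 - lam) *\<^sub>R xs n + lam *\<^sub>R T (xs n) - z =
    (1 - lam) *\<^sub>R (xs n - z) + lam *\<^sub>R (T (xs n) - z)"
    by (simp add: algebra_simps)
  have "norm (T (xs n) - z) \<le> norm (xs n - z)"
    using nonexp fixpoint unfolding nonexpansive_def by metis
  then have "lam * (norm (T (xs n) - z))\<^sup>2 \<le> lam * (norm (xs n - z))\<^sup>2"
    using lam by (intro mult_left_mono power_mono) auto
  then show ?thesis
    unfolding eq norm_convex_combination_sq by (simp add: algebra_simps)
qed

lemma KM_step_le:
  "norm ((1 - lam) *\<^sub>R xs n + lam *\<^sub>R T (xs n) - z) \<le> norm (xs n - z)"
proof (rule power2_le_imp_le)
  have "0 \<le> lam * (1 - lam) * (S n)\<^sup>2"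
    using lam by simp
  then show "(norm ((1 - lam) *\<^sub>R xs n + lam *\<^sub>R T (xs n) - z))\<^sup>2 \<le> (norm (xs n - z))\<^sup>2"
    using KM_step_sq[of n] by linarith
qed simp

lemma dist_step:
  "norm (xs (Suc n) - z) \<le>
     norm ((1 - lam) *\<^sub>R xs n + lam *\<^sub>R T (xs n) - z) + norm (e n)"
proof -
  have "xs (Suc n) - z = ((1 - lam) *\<^sub>R xs n + lam *\<^sub>R T (xs n) - z) + e n"
    by (simp add: step)
  then show ?thesis
    by (metis norm_triangle_ineq)
qed

lemma dist_bound: "norm (xs n - z) \<le> B + 2 * R"
proof -
  \<comment> \<open>Carrying the remaining error budget \<open>R * p n\<close> makes the induction
    close; at the start it equals \<open>2 * R\<close>.\<close>
  have "norm (xs n - z) + R * p n \<le> B + 2 * R"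
  proof (induction n)
    case 0
    show ?case
      using start by simp
  next
    case (Suc n)
    then show ?case
      using dist_step[of n] KM_step_le[of n] error_p[of n] by linarith
  qed
  then show ?thesis
    using R_p_nonneg[of n] by linarith
qed

lemma sum_residuals_sq:
  "lam * (1 - lam) * (\<Sum>i<n. (S i)\<^sup>2) \<le> B\<^sup>2 + 4 * (B + 2 * R) * R"
proof -
  let ?M = "B + 2 * R"
  have M: "0 \<le> ?M"
    using dist_bound[of 0] norm_ge_zero order_trans by blast
  have "(norm (xs n - z))\<^sup>2 + lam * (1 - lam) * (\<Sum>i<n. (S i)\<^sup>2) + 2 * ?M * (R * p n)
    \<le> B\<^sup>2 + 4 * ?M * R"
  proof (induction n)
    case 0
    have "(norm (xs 0 - z))\<^sup>2 \<le> B\<^sup>2"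
      using start by (intro power_mono) auto
    then show ?case
      by (simp add: algebra_simps)
  next
    case (Suc n)
    let ?d = "norm (xs (Suc n) - z)"
    let ?y = "norm ((1 - lam) *\<^sub>R xs n + lam *\<^sub>R T (xs n) - z)"
    \<comment> \<open>Passing to squares multiplies the error by \<open>?d + ?y\<close>, and both of
      these distances are at most \<open>?M\<close>.\<close>
    have "?d\<^sup>2 - ?y\<^sup>2 = (?d + ?y) * (?d - ?y)"
      by (simp add: power2_eq_square algebra_simps)
    also have "\<dots> \<le> (?d + ?y) * norm (e n)"
      using dist_step[of n] by (intro mult_left_mono) auto
    also have "\<dots> \<le> (2 * ?M) * (R * p n - R * p (Suc n))"
      using dist_bound[of "Suc n"] dist_bound[of n] KM_step_le[of n] error_p[of n] M
      by (intro mult_mono) auto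
    also have "\<dots> = 2 * ?M * (R * p n) - 2 * ?M * (R * p (Suc n))"
      by (rule right_diff_distrib)
    finally have "?d\<^sup>2 - ?y\<^sup>2 \<le> 2 * ?M * (R * p n) - 2 * ?M * (R * p (Suc n))" .
    moreover have "lam * (1 - lam) * (\<Sum>i<Suc n. (S i)\<^sup>2) =
      lam * (1 - lam) * (\<Sum>i<n. (S i)\<^sup>2) + lam * (1 - lam) * (S n)\<^sup>2"
      by (simp only: sum.lessThan_Suc distrib_left)
    ultimately show ?case
      using Suc KM_step_sq[of n] by linarith
  qed
  moreover have "0 \<le> 2 * ?M * (R * p n)"
    by (rule mult_nonneg_nonneg) (use M R_p_nonneg in auto)
  ultimately show ?thesis
    using zero_le_power2[of "norm (xs n - z)"] by linarith
qed

section \<open>Increments and decay of the residuals\<close>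

lemma increment_le: "norm (xs (Suc n) - xs n) \<le> lam * S n + norm (e n)"
proof -
  have "xs (Suc n) - xs n = e n - lam *\<^sub>R (xs n - T (xs n))"
    by (simp add: step algebra_simps)
  then have "norm (xs (Suc n) - xs n) \<le> norm (e n) + norm (lam *\<^sub>R (xs n - T (xs n)))"
    by (metis norm_triangle_ineq4)
  then show ?thesis
    using lam by simp
qed

text \<open>The averaged residual contributes \<open>(1 - lam) * S n\<close> and the increment
  \<open>lam * S n\<close>, so the weights add up to 1. Each brings one error norm, hence the factor
  2.\<close>

lemma residual_step: "S (Suc n) \<le> S n + 2 * norm (e n)"
proof -
  have "xs (Suc n) - T (xs (Suc n)) =
    (1 - lam) *\<^sub>R (xs n - T (xs n)) + e n - (T (xs (Suc n)) - T (xs n))"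
    by (simp add: step algebra_simps)
  then have "S (Suc n) \<le>
    norm ((1 - lam) *\<^sub>R (xs n - T (xs n)) + e n) + norm (T (xs (Suc n)) - T (xs n))"
    by (simp only: norm_triangle_ineq4)
  also have "\<dots> \<le> (norm ((1 - lam) *\<^sub>R (xs n - T (xs n))) + norm (e n)) + norm (xs (Suc n) - xs n)"
    using nonexp by (intro add_mono norm_triangle_ineq) (simp add: nonexpansive_def)
  also have "\<dots> \<le> ((1 - lam) * S n + norm (e n)) + (lam * S n + norm (e n))"
    using lam increment_le[of n] by (intro add_mono) auto
  finally show ?thesis
    by (simp add: algebra_simps)
qed

lemma antimono_residual: "antimono (\<lambda>n. S n + 2 * R * p n)"
  unfolding antimono_iff_le_Suc
proof
  fix n
  show "S (Suc n) + 2 * R * p (Suc n) \<le> S n + 2 * R * p n"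
    using residual_step[of n] error_p[of n] by (simp only: mult.assoc)
qed

lemma residual_le:
  fixes k m n :: nat and Lam :: real
  assumes Lam: "1 / (lam * (1 - lam)) \<le> Lam"
    and m: "8 * R * (real k + 1) \<le> real m" "m \<le> n"
    and n: "4 * Lam * (B\<^sup>2 + 4 * (B + 2 * R) * R) * (real k + 1)\<^sup>2 < real (Suc n) - real m"
  shows "S n \<le> 1 / (real k + 1)"
proof -
  \<comment> \<open>Half the target, as the comparison argument yields \<open>2 * d\<close>;
    \<open>1 / d\<^sup>2\<close> is the factor \<open>4 * (k + 1)\<^sup>2\<close> in the assumption
    on \<open>n\<close>.\<close>
  define d where "d = 1 / (2 * (real k + 1))"
  define D where "D = B\<^sup>2 + 4 * (B + 2 * R) * R"
  have c: "0 < lam * (1 - lam)"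
    using lam by simp
  have D: "0 \<le> D"
    using sum_residuals_sq[of 0] by (simp add: D_def)
  have "(\<Sum>i<Suc n. (S i)\<^sup>2) \<le> D / (lam * (1 - lam))"
    using sum_residuals_sq[of "Suc n"] c
    by (subst pos_le_divide_eq) (simp_all only: D_def mult.commute)
  also have "\<dots> \<le> Lam * D"
    using mult_right_mono[OF Lam D] by simp
  finally have sum: "(\<Sum>i<Suc n. (S i)\<^sup>2) \<le> Lam * D" .
  have "d\<^sup>2 = 1 / (4 * (real k + 1)\<^sup>2)"
    by (simp add: d_def power2_eq_square algebra_simps)
  then have C: "Lam * D < (real (Suc n) - real m) * d\<^sup>2"
    using n by (simp add: D_def pos_less_divide_eq algebra_simps)
  \<comment> \<open>The left side is \<open>4 * R / (m + 1)\<close>, which explains the threshold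
    \<open>8 * R * (k + 1)\<close> for \<open>m\<close>.\<close>
  have "2 * R * p m \<le> d"
    using m(1) by (simp add: d_def divide_simps) (simp add: algebra_simps)
  moreover have "antimono (\<lambda>n. 2 * R * p n)"
    using R by (intro antimonoI mult_left_mono divide_left_mono) auto
  ultimately have "S n \<le> 2 * d"
    using le_twice_if_sum_squares_bounded[OF antimono_residual _ _ _ _ m(2) sum C] R
    by (simp add: d_def)
  then show ?thesis
    by (simp add: d_def field_simps)
qed

end

section \<open>The explicit rates\<close>

theorem proposition5p3:
  fixes T :: "'a::{real_inner, complete_space} \<Rightarrow> 'a"
    and lam :: real and L b \<Lambda> R :: nat
    and r x :: 'a and xs :: "nat \<Rightarrow> 'a"
  assumes "nonexpansive T"
    and "Fix T \<noteq> {}"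
    and "0 < lam" and "lam < 1"
    and "L \<ge> 1"
    and "xs 0 = x"
    and "\<And>n. xs (Suc n) =
           (1 - lam) *\<^sub>R xs n + lam *\<^sub>R T (xs n) + (1 / (real n + real L)\<^sup>2) *\<^sub>R r"
    and "\<Lambda> = nat \<lceil>1 / (lam * (1 - lam))\<rceil>"
    and "R = nat \<lceil>norm r\<rceil>"
    and "b \<ge> 1"
    and "\<exists>z\<in>Fix T. real b \<ge> max (norm (x - z)) (norm z)"
  shows "T_asymptotically_regular_with_rate T xs
           (\<lambda>k. 16 * \<Lambda> * (b + 2 * R) * (b + 4 * R + 1) * (k + 1)\<^sup>2
                 + 8 * \<Lambda> * R * (k + 1) + \<Lambda>)
       \<and> asymptotically_regular_with_rate xs
           (\<lambda>k. 64 * \<Lambda> * (b + 2 * R) * (b + 4 * R + 1) * (k + 1)\<^sup>2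
                 + 16 * \<Lambda> * R * (k + 1) + \<Lambda>)"
proof -
  obtain z where z: "T z = z" "norm (x - z) \<le> real b"
    using assms(11) by (auto simp: Fix_def)
  have R: "norm r \<le> real R"
    using assms(9) by linarith
  have Lam: "1 / (lam * (1 - lam)) \<le> real \<Lambda>"
    using assms(8) by linarith
  have "0 < 1 / (lam * (1 - lam))"
    using assms(3,4) by simp
  with Lam have Lam1: "\<Lambda> \<ge> 1"
    by (metis less_one not_le of_nat_0 order_less_le_trans less_irrefl)
  have error: "norm ((1 / (real n + real L)\<^sup>2) *\<^sub>R r) \<le> real R * (2 / (real n + 1) - 2 / (real n + 2))"
    for n
  proof -
    have "1 / (real n + real L)\<^sup>2 * norm r \<le> (2 / (real n + 1) - 2 / (real n + 2)) * real R"
      using inverse_square_le_telescope[OF \<open>L \<ge> 1\<close>, of n] R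
      by (intro mult_mono) (auto intro!: divide_left_mono)
    then show ?thesis
      by (simp add: mult.commute)
  qed
  interpret perturbed_KM T lam "\<lambda>n. (1 / (real n + real L)\<^sup>2) *\<^sub>R r" xs "real R" "real b" z
    by unfold_locales (use assms(1,3,4,6,7) z error in simp_all)
  define \<Phi> where "\<Phi> k = 16 * \<Lambda> * (b + 2 * R) * (b + 4 * R + 1) * (k + 1)\<^sup>2
    + 8 * \<Lambda> * R * (k + 1) + \<Lambda>" for k
  define \<Psi> where "\<Psi> k = 64 * \<Lambda> * (b + 2 * R) * (b + 4 * R + 1) * (k + 1)\<^sup>2
    + 16 * \<Lambda> * R * (k + 1) + \<Lambda>" for k
  have T_rate: "S n \<le> 1 / (real k + 1)" if n: "\<Phi> k \<le> n" for n k
  proof -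
    let ?m = "8 * R * (k + 1)"
    let ?D = "b\<^sup>2 + 4 * (b + 2 * R) * R"
    \<comment> \<open>Expanded, the product exceeds \<open>?D\<close> by
      \<open>2 * b * R + b + 2 * R\<close>.\<close>
    have "?D \<le> (b + 2 * R) * (b + 4 * R + 1)"
      by (simp add: power2_eq_square algebra_simps)
    then have "4 * \<Lambda> * ?D * (k + 1)\<^sup>2 \<le> 16 * \<Lambda> * ((b + 2 * R) * (b + 4 * R + 1)) * (k + 1)\<^sup>2"
      by (intro mult_le_mono) auto
    moreover have "?m \<le> 8 * \<Lambda> * R * (k + 1)"
      using Lam1 by (intro mult_le_mono) auto
    \<comment> \<open>The left side is at most \<open>\<Phi> k\<close>, hence at most
      \<open>n\<close>; the successor makes the inequality strict.\<close>
    ultimately have *: "4 * \<Lambda> * ?D * (k + 1)\<^sup>2 + ?m < Suc n"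
      using n unfolding \<Phi>_def mult.assoc by linarith
    then have "real (4 * \<Lambda> * ?D * (k + 1)\<^sup>2 + ?m) < real (Suc n)"
      by (simp only: of_nat_less_iff)
    then have "4 * real \<Lambda> * ((real b)\<^sup>2 + 4 * (real b + 2 * real R) * real R) * (real k + 1)\<^sup>2
        < real (Suc n) - real ?m"
      by (simp only: of_nat_add of_nat_mult of_nat_power of_nat_numeral of_nat_1 less_diff_eq)
    moreover have "?m \<le> n"
      using * by linarith
    moreover have "8 * real R * (real k + 1) \<le> real ?m"
      by (simp add: algebra_simps)
    ultimately show ?thesis
      using residual_le[OF Lam] by blast
  qed
  have "norm (xs (Suc n) - xs n) \<le> 1 / (real k + 1)" if n: "\<Psi> k \<le> n" for n k
  proof -
    have two: "real (2 * k + 1) + 1 = 2 * (real k + 1)"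
      by simp
    have double: "16 * a * c * d * (2 * q)\<^sup>2 + 8 * a * u * (2 * q) + a
      = 64 * a * c * d * q\<^sup>2 + 16 * a * u * q + a" for a c d q u :: nat
      by (simp add: power2_eq_square)
    have "2 * k + 1 + 1 = 2 * (k + 1)"
      by simp
    \<comment> \<open>Halving the target doubles \<open>k + 1\<close>: the quadratic coefficient 16
      becomes 64 and the linear one 8 becomes 16. The other half of the target is left for the
      error.\<close>
    then have "\<Phi> (2 * k + 1) = \<Psi> k"
      by (simp only: \<Phi>_def \<Psi>_def double)
    then have "S n \<le> 1 / (2 * (real k + 1))"
      using T_rate[of "2 * k + 1" n] n by (simp only: two)
    then have S_le: "lam * S n \<le> 1 / (2 * (real k + 1))"
      using assms(3,4) by (meson less_imp_le mult_left_le_one_le norm_ge_zero order_trans)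
    have e_le: "real R * (2 / (real n + 1) - 2 / (real n + 2)) \<le> 1 / (2 * (real k + 1))"
    proof -
      \<comment> \<open>The linear term of \<open>\<Psi>\<close> alone makes \<open>n\<close> large
        enough for \<open>2 * R / (n + 1)\<close> to fall below half the target.\<close>
      have "4 * R * (k + 1) \<le> 16 * \<Lambda> * R * (k + 1)"
        using Lam1 by (intro mult_le_mono) auto
      then have "4 * R * (k + 1) \<le> n"
        using n unfolding \<Psi>_def by linarith
      then have "real (4 * R * (k + 1)) \<le> real n"
        by (simp only: of_nat_le_iff)
      then have "real R * (2 / (real n + 1)) \<le> 1 / (2 * (real k + 1))"
        by (simp add: divide_simps) (simp add: algebra_simps)
      moreover have "real R * (2 / (real n + 1) - 2 / (real n + 2)) \<le> real R * (2 / (real n + 1))"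
        by (intro mult_left_mono) auto
      ultimately show ?thesis
        by linarith
    qed
    have "norm (xs (Suc n) - xs n) \<le> 1 / (2 * (real k + 1)) + 1 / (2 * (real k + 1))"
      using increment_le by (rule order_trans) (intro add_mono S_le order_trans[OF error e_le])
    then show ?thesis
      by (simp add: field_simps)
  qed
  then have "asymptotically_regular_with_rate xs \<Psi>"
    by (simp add: asymptotically_regular_with_rate_def rate_of_convergence_to_0_def)
  moreover have "T_asymptotically_regular_with_rate T xs \<Phi>"
    using T_rate by (simp add: T_asymptotically_regular_with_rate_def rate_of_convergence_to_0_def)
  ultimately show ?thesis
    unfolding \<Phi>_def \<Psi>_def by blast
qed

end
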